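(* Let $G$ be an edge-coloured graph on $n$ vertices. If either of the conditions below is satisfied, then $G$ has a rainbow triangle. (1) There are at least $\frac{9}{8}n$ colour classes, each of size at least $\frac{n}{3}$. (2) There are at least $n$ colour classes, each of size at least $\frac{2n}{5}$.
   Context: Graphs are finite, undirected and simple, with at least one vertex. An edge-coloured graph is a graph $G=(V,E)$ equipped with a distinguished partition $\{C_1,\ldots,C_p\}$ of $E$ (into nonempty parts); the sets $C_i$ are called colour classes, the indices $i$ are called colours, and an edge $e$ has colour $i$ if $e\in C_i$. (The colouring need not be proper.) The size of a colour class is its number of edges. A subgraph $H$ of $G$ is rainbow if distinct edges of $H$ have distinct colours. A triangle is a subgraph isomorphic to $K_3$. *)

theory Defs
  imports Complex_Main "HOL-Library.Disjoint_Sets" "HOL-Library.Ramsey"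
begin

text \<open>
  An undirected simple graph is given by its vertex set and its edge set, every edge being a
  2-element set of vertices (this excludes loops and multiple edges).
\<close>

locale simple_graph =
  fixes V :: "'a set" and E :: "'a set set"
  assumes finite_V: "finite V"
    and V_nonempty: "V \<noteq> {}"
    and edges_subset: "E \<subseteq> [V]\<^bsup>2\<^esup>"

text \<open>
  The colouring is the partition \<open>P\<close> of the edge set itself; its members are the colour classes.
  By \<^const>\<open>partition_on\<close> they are nonempty, pairwise disjoint, and cover \<open>E\<close>. Properness is
  not required.
\<close>

locale edge_coloured_graph = simple_graph V E
  for V :: "'a set" and E :: "'a set set" +
  fixes P :: "'a set set set"
  assumes colour_classes: "partition_on E P"

definition subgraph_of :: "'a set \<Rightarrow> 'a set set \<Rightarrow> 'a set \<Rightarrow> 'a set set \<Rightarrow> bool" where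
  "subgraph_of W F V E \<longleftrightarrow> simple_graph W F \<and> W \<subseteq> V \<and> F \<subseteq> E"

definition graph_isomorphic ::
    "'a set \<Rightarrow> 'a set set \<Rightarrow> 'b set \<Rightarrow> 'b set set \<Rightarrow> bool" where
  "graph_isomorphic V E W F \<longleftrightarrow>
     (\<exists>h. bij_betw h V W \<and> (\<forall>u\<in>V. \<forall>v\<in>V. {u, v} \<in> E \<longleftrightarrow> {h u, h v} \<in> F))"

text \<open>The right-hand graph below is \<open>K\<^sub>3\<close> on the vertices 0, 1, 2.\<close>

definition is_triangle :: "'a set \<Rightarrow> 'a set set \<Rightarrow> bool" where
  "is_triangle W F \<longleftrightarrow> graph_isomorphic W F {..<3::nat} ([{..<3::nat}]\<^bsup>2\<^esup>)"

definition rainbow :: "'a set set set \<Rightarrow> 'a set set \<Rightarrow> bool" where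
  "rainbow P F \<longleftrightarrow> (\<forall>e\<in>F. \<forall>f\<in>F. e \<noteq> f \<longrightarrow> \<not> (\<exists>C\<in>P. e \<in> C \<and> f \<in> C))"

definition has_rainbow_triangle :: "'a set \<Rightarrow> 'a set set \<Rightarrow> 'a set set set \<Rightarrow> bool" where
  "has_rainbow_triangle V E P \<longleftrightarrow>
     (\<exists>W F. subgraph_of W F V E \<and> is_triangle W F \<and> rainbow P F)"

end

theory Submission
  imports Defs "HOL-Analysis.Convex"
begin

text \<open>
  Keep exactly \<open>k\<close> edges of each of \<open>m\<close> large colour classes, giving a graph with \<open>e = m k\<close> edges.
  By Goodman's bound it has at least \<open>e (4 e - n\<^sup>2) / (3 n)\<close> triangles. If no triangle is rainbow, each
  one contains two adjacent edges of the same colour, and there are at most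
  \<open>m k (k - 1) / 2\<close> such pairs. Hence \<open>8 m k \<le> 2 n\<^sup>2 + 3 n (k - 1)\<close>. Both \<open>(m, k) = (9n/8, n/3)\<close> and
  \<open>(m, k) = (n, 2n/5)\<close> satisfy \<open>8 m k = 2 n\<^sup>2 + 3 n k\<close>, so they narrowly violate this inequality.
\<close>

text \<open>Triangles are counted as ordered triples throughout, that is, each one six times.\<close>

lemma goodman_bound:
  fixes F :: "'a set set"
  assumes "finite V" and FV: "F \<subseteq> [V]\<^bsup>2\<^esup>"
  shows "8 * (real (card F))\<^sup>2 \<le> real (card V) * (2 * real (card V) * real (card F) +
    real (card {(u, v, w). {u, v} \<in> F \<and> {v, w} \<in> F \<and> {u, w} \<in> F}))"
proof -
  define a :: "'a \<Rightarrow> 'a \<Rightarrow> real" where "a u v = of_bool ({u, v} \<in> F)" for u v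
  define d where "d u = (\<Sum>v\<in>V. a u v)" for u
  have sym: "a u v = a v u" for u v
    by (simp add: a_def insert_commute)
  have inV: "u \<in> V" "v \<in> V" "u \<noteq> v" if "{u, v} \<in> F" for u v
    using that FV by (auto simp: nsets_def card_insert_if split: if_splits)
  have finF: "finite F"
    using FV \<open>finite V\<close> finite_imp_finite_nsets finite_subset by blast
  \<comment> \<open>Handshake identity: the ordered pairs of adjacent vertices are grouped by the
    edge they span, two pairs for each edge.\<close>
  have sum_d: "(\<Sum>u\<in>V. d u) = 2 * real (card F)"
  proof -
    have "(\<Sum>u\<in>V. d u) = (\<Sum>x\<in>V \<times> V. of_bool ({fst x, snd x} \<in> F))"
      by (simp add: d_def a_def sum.cartesian_product case_prod_beta)
    also have "\<dots> = real (card {x \<in> V \<times> V. {fst x, snd x} \<in> F})"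
      using \<open>finite V\<close> by (simp add: of_bool_def sum.If_cases Int_def)
    also have "{x \<in> V \<times> V. {fst x, snd x} \<in> F} = (\<Union>e\<in>F. {x. {fst x, snd x} = e})"
      using inV by auto
    also have "card \<dots> = (\<Sum>e\<in>F. card {x. {fst x, snd x} = e})"
    proof (rule card_UN_disjoint[OF finF])
      show "\<forall>e\<in>F. finite {x. {fst x, snd x} = e}"
      proof
        fix e assume "e \<in> F"
        then have "finite e" using FV by (auto simp: nsets_def)
        moreover have "{x. {fst x, snd x} = e} \<subseteq> e \<times> e" by auto
        ultimately show "finite {x. {fst x, snd x} = e}"
          by (meson finite_SigmaI finite_subset)
      qed
    qed auto
    also have "\<dots> = (\<Sum>e\<in>F. 2)"
    proof (rule sum.cong[OF refl])
      fix e assume "e \<in> F"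
      then obtain p q where e: "e = {p, q}" "p \<noteq> q"
        using FV by (auto simp: nsets_def card_2_iff)
      then have "{x. {fst x, snd x} = e} = {(p, q), (q, p)}"
        by (auto simp: doubleton_eq_iff)
      then show "card {x. {fst x, snd x} = e} = 2"
        using e by simp
    qed
    finally show ?thesis by simp
  qed
  \<comment> \<open>Two neighbourhoods inside \<open>V\<close> overlap in at least the sum of their
    sizes minus \<open>card V\<close>. Termwise this is \<open>x + y - 1 \<le> x * y\<close> for
    \<open>x\<close> and \<open>y\<close> in {0, 1}.\<close>
  have codeg: "(\<Sum>w\<in>V. a u w * a v w) \<ge> d u + d v - card V" for u v
  proof -
    have "d u + d v - card V = (\<Sum>w\<in>V. a u w + a v w - 1)"
      by (simp add: d_def sum.distrib sum_subtractf)
    also have "\<dots> \<le> (\<Sum>w\<in>V. a u w * a v w)"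
      by (rule sum_mono) (auto simp: a_def)
    finally show ?thesis .
  qed
  have T: "real (card {(u, v, w). {u, v} \<in> F \<and> {v, w} \<in> F \<and> {u, w} \<in> F}) =
    (\<Sum>u\<in>V. \<Sum>v\<in>V. a u v * (\<Sum>w\<in>V. a u w * a v w))" (is "real (card ?T) = _")
  proof -
    have "(\<Sum>u\<in>V. \<Sum>v\<in>V. a u v * (\<Sum>w\<in>V. a u w * a v w)) =
        (\<Sum>x\<in>V \<times> V \<times> V. of_bool (x \<in> ?T))"
      by (simp add: sum_distrib_left sum.cartesian_product case_prod_beta a_def of_bool_conj)
        (auto intro!: sum.cong)
    also have "\<dots> = real (card {x \<in> V \<times> V \<times> V. x \<in> ?T})"
      using \<open>finite V\<close> by (simp add: of_bool_def sum.If_cases Int_def)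
    also have "{x \<in> V \<times> V \<times> V. x \<in> ?T} = ?T"
      using inV by auto
    finally show ?thesis by simp
  qed
  have adu: "(\<Sum>u\<in>V. \<Sum>v\<in>V. a u v * d u) = (\<Sum>u\<in>V. (d u)\<^sup>2)"
    by (simp add: d_def sum_distrib_right power2_eq_square)
  have adv: "(\<Sum>u\<in>V. \<Sum>v\<in>V. a u v * d v) = (\<Sum>u\<in>V. (d u)\<^sup>2)"
    by (subst sum.swap) (use adu in \<open>simp add: sym\<close>)
  \<comment> \<open>The bound \<open>codeg\<close> is summed over all ordered adjacent pairs. Each
    vertex \<open>u\<close> is the first end of \<open>d u\<close> of them and the second end of as
    many, hence the two sums of squares.\<close>
  have "2 * (\<Sum>u\<in>V. (d u)\<^sup>2) - card V * (2 * card F) =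
      (\<Sum>u\<in>V. \<Sum>v\<in>V. a u v * d u) + (\<Sum>u\<in>V. \<Sum>v\<in>V. a u v * d v) - card V * (\<Sum>u\<in>V. d u)"
    by (simp add: adu adv sum_d)
  also have "\<dots> = (\<Sum>u\<in>V. \<Sum>v\<in>V. a u v * (d u + d v - card V))"
    by (simp add: sum.distrib sum_subtractf sum_distrib_left d_def algebra_simps)
  also have "\<dots> \<le> (\<Sum>u\<in>V. \<Sum>v\<in>V. a u v * (\<Sum>w\<in>V. a u w * a v w))"
    by (intro sum_mono mult_left_mono codeg) (simp add: a_def)
  finally have lower: "2 * (\<Sum>u\<in>V. (d u)\<^sup>2) - card V * (2 * card F) \<le> card ?T"
    by (simp add: T)
  \<comment> \<open>Cauchy-Schwarz replaces the degree squares by the known degree sum.\<close>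
  have "(\<Sum>u\<in>V. d u)\<^sup>2 \<le> card V * (\<Sum>u\<in>V. (d u)\<^sup>2)"
    using sum_squared_le_sum_of_squares[of d V] by (simp add: mult.commute)
  then have "8 * (real (card F))\<^sup>2 \<le> card V * (2 * (\<Sum>u\<in>V. (d u)\<^sup>2))"
    by (simp add: sum_d power2_eq_square)
  also have "\<dots> \<le> card V * (2 * real (card V) * card F + card ?T)"
    using lower by (intro mult_left_mono) auto
  finally show ?thesis .
qed

text \<open>Since \<open>u \<noteq> w\<close>, the sets \<open>{u, v}\<close> and
  \<open>{v, w}\<close> are distinct and meet exactly in \<open>v\<close>. So the ordered pair of
  them determines the triple, and each class offers \<open>k * (k - 1)\<close> such pairs.\<close>

lemma card_monochromatic_cherries:
  fixes Q :: "'a set set set"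
  assumes fin: "finite Q" "k > 0" and k: "\<And>C. C \<in> Q \<Longrightarrow> card C = k"
  defines "M \<equiv> {(u, v, w). u \<noteq> w \<and> (\<exists>C\<in>Q. {u, v} \<in> C \<and> {v, w} \<in> C)}"
  shows "finite M" and "card M \<le> card Q * (k * (k - 1))"
proof -
  define D where "D = (\<Union>C\<in>Q. SIGMA e:C. C - {e})"
  have finC: "finite C" if "C \<in> Q" for C
    using k[OF that] \<open>k > 0\<close> card_gt_0_iff by force
  have finD: "finite D"
    using fin finC by (auto simp: D_def)
  let ?f = "\<lambda>(u, v, w). ({u, v}, {v, w})"
  have inj: "inj_on ?f M"
    by (auto simp: inj_on_def M_def doubleton_eq_iff)
  have sub: "?f ` M \<subseteq> D"
    by (auto simp: M_def D_def doubleton_eq_iff)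
  show "finite M"
    using inj sub finD by (meson finite_imageD finite_subset)
  have "card M \<le> card D"
    using inj sub finD by (rule card_inj_on_le)
  also have "\<dots> \<le> (\<Sum>C\<in>Q. card (SIGMA e:C. C - {e}))"
    unfolding D_def by (rule card_UN_le) (rule fin)
  also have "\<dots> = (\<Sum>C\<in>Q. k * (k - 1))"
    by (intro sum.cong refl) (simp add: finC k card_SigmaI)
  finally show "card M \<le> card Q * (k * (k - 1))" by simp
qed

text \<open>The condition on triangles mentions only \<open>Q\<close>, so the bound can be applied
  to the subgraph of kept edges. Equal class sizes turn both counts into multiples of
  \<open>card Q * k\<close>, which cancels.\<close>

lemma no_rainbow_triangle_bound:
  fixes Q :: "'a set set set"
  assumes "finite V" and QV: "\<Union>Q \<subseteq> [V]\<^bsup>2\<^esup>" and disj: "disjoint Q"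
    and k: "\<And>C. C \<in> Q \<Longrightarrow> card C = k" and "k > 0" "Q \<noteq> {}"
    and nr: "\<And>u v w. {u, v} \<in> \<Union>Q \<Longrightarrow> {v, w} \<in> \<Union>Q \<Longrightarrow> {u, w} \<in> \<Union>Q \<Longrightarrow>
      \<exists>C\<in>Q. {u, v} \<in> C \<and> {v, w} \<in> C \<or> {u, v} \<in> C \<and> {u, w} \<in> C \<or> {v, w} \<in> C \<and> {u, w} \<in> C"
  shows "8 * real (card Q) * real k \<le>
    2 * (real (card V))\<^sup>2 + 3 * real (card V) * (real k - 1)"
proof -
  let ?F = "\<Union>Q"
  let ?T = "{(u, v, w). {u, v} \<in> ?F \<and> {v, w} \<in> ?F \<and> {u, w} \<in> ?F}"
  let ?m = "card Q" and ?n = "card V"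
  have finF: "finite ?F"
    using QV \<open>finite V\<close> finite_imp_finite_nsets finite_subset by blast
  then have finQ: "finite Q"
    by (rule finite_UnionD)
  have finC: "finite C" if "C \<in> Q" for C
    using that finF by (meson Union_upper finite_subset)
  have card_F: "card ?F = ?m * k"
    using card_Union_disjoint[of Q] disj finC k
    by (simp add: disjoint_def pairwise_def disjnt_def)
  define M where "M = {(u, v, w). u \<noteq> w \<and> (\<exists>C\<in>Q. {u, v} \<in> C \<and> {v, w} \<in> C)}"
  have M: "finite M" "card M \<le> ?m * (k * (k - 1))"
    using card_monochromatic_cherries[OF finQ \<open>k > 0\<close> k] unfolding M_def by auto
  \<comment> \<open>In a triple of \<open>M\<close> the two edges of one colour meet at the middle
    vertex; in \<open>M2\<close> they meet at the first vertex and in \<open>M3\<close> at the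
    last.\<close>
  define M2 where "M2 = (\<lambda>(u, v, w). (v, u, w)) ` M"
  define M3 where "M3 = (\<lambda>(u, v, w). (u, w, v)) ` M"
  have "card ?T \<le> card (M \<union> M2 \<union> M3)"
  proof (rule card_mono)
    show "finite (M \<union> M2 \<union> M3)"
      using M by (simp add: M2_def M3_def)
    show "?T \<subseteq> M \<union> M2 \<union> M3"
    proof
      fix t assume "t \<in> ?T"
      then obtain u v w where t: "t = (u, v, w)"
        and e: "{u, v} \<in> ?F" "{v, w} \<in> ?F" "{u, w} \<in> ?F"
        by blast
      then have "{u, v} \<in> [V]\<^bsup>2\<^esup>" "{v, w} \<in> [V]\<^bsup>2\<^esup>" "{u, w} \<in> [V]\<^bsup>2\<^esup>"
        using QV by blast+
      then have "u \<noteq> v" "v \<noteq> w" "u \<noteq> w"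
        by simp_all
      then have "(u, v, w) \<in> M \<or> (v, u, w) \<in> M \<or> (u, w, v) \<in> M"
        using nr[OF e] unfolding M_def by (auto simp: insert_commute)
      then show "t \<in> M \<union> M2 \<union> M3"
        unfolding t M2_def M3_def by force
    qed
  qed
  also have "\<dots> \<le> card M + card M2 + card M3"
    by (meson add_le_mono card_Un_le le_refl le_trans)
  also have "\<dots> \<le> 3 * card M"
    using card_image_le[OF M(1), of "\<lambda>(u, v, w). (v, u, w)"]
      card_image_le[OF M(1), of "\<lambda>(u, v, w). (u, w, v)"]
    unfolding M2_def M3_def by linarith
  also have "\<dots> \<le> 3 * (?m * (k * (k - 1)))"
    using M by simp
  finally have "real (card ?T) \<le> real (3 * (?m * (k * (k - 1))))"
    by (simp only: of_nat_le_iff)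
  \<comment> \<open>Positivity of \<open>k\<close> makes the natural subtraction
    \<open>k - 1\<close> agree with the real one.\<close>
  then have upper: "real (card ?T) \<le> real ?m * k * (3 * (real k - 1))"
    using \<open>k > 0\<close> by (simp add: of_nat_diff algebra_simps)
  have "8 * (real (card ?F))\<^sup>2 \<le> ?n * (2 * real ?n * card ?F + card ?T)"
    by (rule goodman_bound) fact+
  also have "\<dots> \<le> ?n * (2 * real ?n * card ?F + real ?m * k * (3 * (real k - 1)))"
    using upper by (intro mult_left_mono add_left_mono) auto
  finally have "(real ?m * k) * (8 * real ?m * k) \<le>
      (real ?m * k) * (2 * (real ?n)\<^sup>2 + 3 * real ?n * (real k - 1))"
    by (simp add: card_F power2_eq_square algebra_simps)
  moreover have "real ?m * k > 0"
    using \<open>k > 0\<close> \<open>Q \<noteq> {}\<close> finQ by (simp add: card_gt_0_iff)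
  ultimately show ?thesis
    by (rule mult_left_le_imp_le)
qed

text \<open>Reduces the isomorphism in the definition of a triangle to three explicit edges. The
  vertices are distinct because edges are 2-element sets.\<close>

lemma has_rainbow_triangleI:
  assumes "edge_coloured_graph V E P"
    and e: "{u, v} \<in> E" "{v, w} \<in> E" "{u, w} \<in> E"
    and nm: "\<And>C. C \<in> P \<Longrightarrow> \<not> ({u, v} \<in> C \<and> {v, w} \<in> C)"
      "\<And>C. C \<in> P \<Longrightarrow> \<not> ({u, v} \<in> C \<and> {u, w} \<in> C)"
      "\<And>C. C \<in> P \<Longrightarrow> \<not> ({v, w} \<in> C \<and> {u, w} \<in> C)"
  shows "has_rainbow_triangle V E P"
proof -
  interpret edge_coloured_graph V E P by fact
  let ?W = "{u, v, w}" and ?F = "{{u, v}, {v, w}, {u, w}}"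
  have "{u, v} \<in> [V]\<^bsup>2\<^esup>" "{v, w} \<in> [V]\<^bsup>2\<^esup>" "{u, w} \<in> [V]\<^bsup>2\<^esup>"
    using e edges_subset by blast+
  then have ne: "u \<noteq> v" "v \<noteq> w" "u \<noteq> w" and V: "u \<in> V" "v \<in> V" "w \<in> V"
    by simp_all
  have "subgraph_of ?W ?F V E"
    using e V ne by (auto simp: subgraph_of_def simple_graph_def nsets_def)
  moreover have "is_triangle ?W ?F"
  proof -
    define h :: "'a \<Rightarrow> nat" where "h x = (if x = u then 0 else if x = v then 1 else 2)" for x
    have three: "{..<3} = {0, 1, 2::nat}" by auto
    have "bij_betw h ?W {..<3}"
      using ne by (auto simp: bij_betw_def inj_on_def h_def three)
    moreover have "\<forall>x\<in>?W. \<forall>y\<in>?W. {x, y} \<in> ?F \<longleftrightarrow> {h x, h y} \<in> [{..<3}]\<^bsup>2\<^esup>"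
      using ne by (auto simp: nsets_def h_def doubleton_eq_iff)
    ultimately show ?thesis
      unfolding is_triangle_def graph_isomorphic_def by blast
  qed
  moreover have "rainbow P ?F"
    using nm by (auto simp: rainbow_def)
  ultimately show ?thesis
    unfolding has_rainbow_triangle_def by blast
qed

text \<open>Covers both conditions at once: \<open>ab\<close> is the inequality
  \<open>8 m k \<ge> 2 n^2 + 3 n k\<close> at \<open>m = \<alpha> n\<close>,
  \<open>k = \<beta> n\<close>, divided by \<open>n^2\<close>.\<close>

lemma rainbow_triangle_if_large_classes:
  assumes G: "edge_coloured_graph V E P" and n: "card V = n"
    and pos: "\<alpha> > 3 / 8" "\<beta> > 0" and ab: "\<beta> * (8 * \<alpha> - 3) \<ge> 2"
    and num: "real (card {C \<in> P. real (card C) \<ge> \<beta> * real n}) \<ge> \<alpha> * real n"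
  shows "has_rainbow_triangle V E P"
proof (rule ccontr)
  assume no: "\<not> has_rainbow_triangle V E P"
  interpret edge_coloured_graph V E P by fact
  have "n > 0" using n finite_V V_nonempty by (auto simp: card_gt_0_iff)
  \<comment> \<open>Class sizes are integers, so every class in \<open>S\<close> still has
    \<open>k\<close> edges after the threshold is rounded up.\<close>
  define k where "k = nat \<lceil>\<beta> * real n\<rceil>"
  have "\<beta> * n > 0" using pos \<open>n > 0\<close> by simp
  then have "k > 0" and k_ge: "\<beta> * n \<le> k"
    unfolding k_def by linarith+
  define S where "S = {C \<in> P. real (card C) \<ge> \<beta> * real n}"
  have "\<exists>D\<subseteq>C. card D = k" if "C \<in> S" for C
  proof (rule obtain_subset_with_card_n)
    show "k \<le> card C" using that unfolding S_def k_def by (auto simp: ceiling_le_iff nat_le_iff)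
  qed blast
  then obtain f where f: "\<And>C. C \<in> S \<Longrightarrow> f C \<subseteq> C" "\<And>C. C \<in> S \<Longrightarrow> card (f C) = k"
    by metis
  have P: "\<Union>P = E" "disjoint P"
    using colour_classes by (auto simp: partition_on_def)
  have same: "C = D" if "C \<in> P" "D \<in> P" "x \<in> C" "x \<in> D" for C D x
    using that P(2) by (auto simp: disjoint_def)
  have f_ne: "\<exists>x. x \<in> f C" if "C \<in> S" for C
    using f(2)[OF that] \<open>k > 0\<close> by (metis card.empty ex_in_conv less_irrefl)
  have SP: "S \<subseteq> P" by (auto simp: S_def)
  \<comment> \<open>Trimming merges no colours: the kept parts are nonempty subsets of disjoint
    classes.\<close>
  have inj: "inj_on f S"
    using f_ne f(1) same SP by (intro inj_onI) (metis subsetD)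
  have EV: "\<Union>(f ` S) \<subseteq> E"
    using f(1) SP P by blast
  have m: "\<alpha> * n \<le> card (f ` S)"
    using num inj by (simp add: card_image S_def)
  have "\<alpha> * n > 0" using pos \<open>n > 0\<close> by simp
  then have "f ` S \<noteq> {}" using m by (metis card.empty of_nat_0 not_le)
  have "8 * real (card (f ` S)) * real k \<le>
      2 * (real (card V))\<^sup>2 + 3 * real (card V) * (real k - 1)"
  proof (rule no_rainbow_triangle_bound)
    show "disjoint (f ` S)"
      using f(1) SP same unfolding disjoint_def by (blast dest: subsetD)
    fix u v w
    assume e: "{u, v} \<in> \<Union>(f ` S)" "{v, w} \<in> \<Union>(f ` S)" "{u, w} \<in> \<Union>(f ` S)"
    \<comment> \<open>A kept edge lies in only one class of \<open>P\<close>, so two kept edges that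
      share the class \<open>D\<close> also share the trimmed class \<open>f D\<close>.\<close>
    have lift: "D \<in> S \<and> x \<in> f D" if "x \<in> D" "D \<in> P" "x \<in> \<Union>(f ` S)" for x D
      using that f(1) SP same by blast
    have "\<exists>D\<in>P. {u, v} \<in> D \<and> {v, w} \<in> D \<or> {u, v} \<in> D \<and> {u, w} \<in> D \<or> {v, w} \<in> D \<and> {u, w} \<in> D"
      using has_rainbow_triangleI[OF G, of u v w] no e EV by blast
    then show "\<exists>C\<in>f ` S. {u, v} \<in> C \<and> {v, w} \<in> C \<or> {u, v} \<in> C \<and> {u, w} \<in> C \<or>
        {v, w} \<in> C \<and> {u, w} \<in> C"
      using lift e by (metis imageI)
  qed (use finite_V EV edges_subset f \<open>k > 0\<close> \<open>f ` S \<noteq> {}\<close> in auto)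
  \<comment> \<open>With all terms in \<open>k\<close> on the left, both factors are bounded below
    and the product is at least \<open>2 n^2\<close>. The \<open>- 3 * n\<close>, left over from
    \<open>k - 1\<close>, gives the contradiction even when equality holds in
    \<open>ab\<close>.\<close>
  then have "(8 * real (card (f ` S)) - 3 * n) * k \<le> 2 * (real n)\<^sup>2 - 3 * n"
    by (simp add: n algebra_simps)
  moreover have "(8 * real (card (f ` S)) - 3 * n) * k \<ge> ((8 * \<alpha> - 3) * n) * (\<beta> * n)"
  proof (rule mult_mono)
    show le: "(8 * \<alpha> - 3) * n \<le> 8 * real (card (f ` S)) - 3 * n"
      using m by (simp add: algebra_simps)
    have "0 \<le> (8 * \<alpha> - 3) * n" using pos by simp
    then show "0 \<le> 8 * real (card (f ` S)) - 3 * n" using le by linarith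
  qed (use k_ge \<open>\<beta> * n > 0\<close> in auto)
  moreover have "((8 * \<alpha> - 3) * n) * (\<beta> * n) \<ge> 2 * (real n)\<^sup>2"
    using mult_right_mono[OF ab, of "(real n)\<^sup>2"] by (simp add: power2_eq_square algebra_simps)
  ultimately show False
    using \<open>n > 0\<close> by simp
qed

theorem theorem2p1:
  fixes V :: "'a set" and E :: "'a set set" and P :: "'a set set set" and n :: nat
  assumes "edge_coloured_graph V E P"
    and "card V = n"
    and "real (card {C \<in> P. real (card C) \<ge> real n / 3}) \<ge> 9 / 8 * real n \<or>
         real (card {C \<in> P. real (card C) \<ge> 2 * real n / 5}) \<ge> real n"
  shows "has_rainbow_triangle V E P"
  using assms(3)
    rainbow_triangle_if_large_classes[OF assms(1,2), of "9 / 8" "1 / 3"]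
    rainbow_triangle_if_large_classes[OF assms(1,2), of 1 "2 / 5"]
  by auto

end
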